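(* Let $f:\mathbb{R}^n\to(-\infty,+\infty]$ and $g:\mathbb{R}^m\to(-\infty,+\infty]$ be proper, closed and convex, with $f$ $\sigma$-strongly convex for some $\sigma>0$, and let $\mathbf{A}$ be a real $m\times n$ matrix. Let $\mathbf{y}_*$ be a maximizer of the dual function $q$. Let $\{\mathbf{y}_k,\mathbf{w}_k\}$ be the sequence generated by the GFDPG method (defined in the context) with $t_k=\frac{k+a}{a}$ for any $a>2$. Then for any $k\ge1$, $$\min\Big\{\{\|\mathbf{y}_i-\mathbf{w}_{i-1}\|\}_{i=1}^k,\ \|p_{L_k'}(\mathbf{y}_k)-\mathbf{y}_k\|\Big\}\le\frac{a\sqrt6}{\sqrt{a-2}}\,\frac{\|\mathbf{y}_0-\mathbf{y}_*\|}{k^{1.5}}$$ for any $L_k'$ that satisfies $\tilde q(p_{L_k'}(\mathbf{y}_k))\le Q_{L_k'}(p_{L_k'}(\mathbf{y}_k),\mathbf{y}_k)$, where $\mathbf{y}_i=p_{L_i}(\mathbf{w}_{i-1})$.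
   Context: Convex conjugates: $f^*(\mathbf{u})=\max_{\mathbf{x}}\{\langle\mathbf{u},\mathbf{x}\rangle-f(\mathbf{x})\}$, $g^*(\mathbf{y})=\max_{\mathbf{z}}\{\langle\mathbf{y},\mathbf{z}\rangle-g(\mathbf{z})\}$. Put $F(\mathbf{y}):=f^*(\mathbf{A}^\top\mathbf{y})$ (differentiable with Lipschitz gradient) and $G(\mathbf{y}):=g^*(-\mathbf{y})$. The dual function is $q(\mathbf{y}):=-F(\mathbf{y})-G(\mathbf{y})$, and $\tilde q:=-q=F+G$; $\mathbf{y}_*$ is equivalently a minimizer of $\tilde q$. For $L>0$ and $\mathbf{y},\mathbf{w}\in\mathbb{R}^m$, $$Q_L(\mathbf{y},\mathbf{w}):=F(\mathbf{w})+\langle\mathbf{y}-\mathbf{w},\nabla F(\mathbf{w})\rangle+\tfrac{L}{2}\|\mathbf{y}-\mathbf{w}\|^2+G(\mathbf{y}),\qquad p_L(\mathbf{w}):=\operatorname{argmin}_{\mathbf{y}}Q_L(\mathbf{y},\mathbf{w}).$$ $\|\cdot\|$ is the Euclidean norm. GFDPG method (with backtracking): given $L_0>0$, $\mathbf{y}_0=\mathbf{w}_0\in\mathbb{R}^m$, $t_0=T_0\in(0,1]$, for $k\ge1$: choose $L_k$ such that $L_{k-1}\le L_k$ and $\tilde q(p_{L_k}(\mathbf{w}_{k-1}))\le Q_{L_k}(p_{L_k}(\mathbf{w}_{k-1}),\mathbf{w}_{k-1})$; set $\mathbf{y}_k=p_{L_k}(\mathbf{w}_{k-1})$; choose $t_k$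 such that $t_k>0$ and $t_k^2\le T_k:=\sum_{i=0}^kt_i$; set $$\mathbf{w}_k=\mathbf{y}_k+\frac{(T_{k-1}-t_{k-1})t_k}{t_{k-1}T_k}(\mathbf{y}_k-\mathbf{y}_{k-1})+\frac{(t_{k-1}^2-T_{k-1})t_k}{t_{k-1}T_k}(\mathbf{y}_k-\mathbf{w}_{k-1}).$$ Here $t_k=\frac{k+a}{a}$ for all $k\ge0$ (so $t_0=1$). *)

theory Defs
  imports "HOL-Analysis.Analysis"
begin

definition proper :: "('a \<Rightarrow> ereal) \<Rightarrow> bool" where
  "proper f \<longleftrightarrow> (\<forall>x. f x \<noteq> -\<infinity>) \<and> (\<exists>x. f x \<noteq> \<infinity>)"

(* The library's epigraph is for real-valued functions only. *)
definition ereal_epigraph :: "('a \<Rightarrow> ereal) \<Rightarrow> ('a \<times> real) set" where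
  "ereal_epigraph f = {(x, r). f x \<le> ereal r}"

definition closed_fun :: "('a::topological_space \<Rightarrow> ereal) \<Rightarrow> bool" where
  "closed_fun f \<longleftrightarrow> closed (ereal_epigraph f)"

definition convex_fun :: "('a::real_vector \<Rightarrow> ereal) \<Rightarrow> bool" where
  "convex_fun f \<longleftrightarrow>
     (\<forall>x y. \<forall>s::real. 0 \<le> s \<and> s \<le> 1 \<longrightarrow>
        f (s *\<^sub>R x + (1 - s) *\<^sub>R y) \<le> ereal s * f x + ereal (1 - s) * f y)"

definition strongly_convex_fun :: "real \<Rightarrow> ('a::real_normed_vector \<Rightarrow> ereal) \<Rightarrow> bool" where
  "strongly_convex_fun \<sigma> f \<longleftrightarrow>
     (\<forall>x y. \<forall>s::real. 0 \<le> s \<and> s \<le> 1 \<longrightarrow>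
        f (s *\<^sub>R x + (1 - s) *\<^sub>R y)
          \<le> ereal s * f x + ereal (1 - s) * f y - ereal (\<sigma> / 2 * s * (1 - s) * (norm (x - y))\<^sup>2))"

definition conjugate :: "('a::real_inner \<Rightarrow> ereal) \<Rightarrow> 'a \<Rightarrow> ereal" where
  "conjugate f u = (SUP x. ereal (u \<bullet> x) - f x)"

definition gradient :: "('a::real_inner \<Rightarrow> real) \<Rightarrow> 'a \<Rightarrow> 'a" where
  "gradient h x = (THE D. GDERIV h x :> D)"

definition F_fun :: "(real^'n \<Rightarrow> ereal) \<Rightarrow> real^'n^'m \<Rightarrow> real^'m \<Rightarrow> ereal" where
  "F_fun f A y = conjugate f (transpose A *v y)"

definition G_fun :: "(real^'m \<Rightarrow> ereal) \<Rightarrow> real^'m \<Rightarrow> ereal" where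
  "G_fun g y = conjugate g (- y)"

definition dual_fun ::
    "(real^'n \<Rightarrow> ereal) \<Rightarrow> (real^'m \<Rightarrow> ereal) \<Rightarrow> real^'n^'m \<Rightarrow> real^'m \<Rightarrow> ereal" where
  "dual_fun f g A y = - F_fun f A y - G_fun g y"

definition neg_dual_fun ::
    "(real^'n \<Rightarrow> ereal) \<Rightarrow> (real^'m \<Rightarrow> ereal) \<Rightarrow> real^'n^'m \<Rightarrow> real^'m \<Rightarrow> ereal" where
  "neg_dual_fun f g A y = - dual_fun f g A y"

(* When f is proper, closed and strongly convex, F_fun f A is finite everywhere, so
   real_of_ereal (F_fun f A v) is the genuine value of F at v and not the default 0. *)
definition Q_fun ::
    "(real^'n \<Rightarrow> ereal) \<Rightarrow> (real^'m \<Rightarrow> ereal) \<Rightarrow> real^'n^'m \<Rightarrow> real \<Rightarrow> real^'m \<Rightarrow> real^'m \<Rightarrow> ereal" where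
  "Q_fun f g A L y w =
     F_fun f A w
     + ereal ((y - w) \<bullet> gradient (\<lambda>v. real_of_ereal (F_fun f A v)) w)
     + ereal (L / 2 * (norm (y - w))\<^sup>2)
     + G_fun g y"

definition p_map ::
    "(real^'n \<Rightarrow> ereal) \<Rightarrow> (real^'m \<Rightarrow> ereal) \<Rightarrow> real^'n^'m \<Rightarrow> real \<Rightarrow> real^'m \<Rightarrow> real^'m" where
  "p_map f g A L w = arg_min (\<lambda>y. Q_fun f g A L y w) (\<lambda>_. True)"

definition descent_cond ::
    "(real^'n \<Rightarrow> ereal) \<Rightarrow> (real^'m \<Rightarrow> ereal) \<Rightarrow> real^'n^'m \<Rightarrow> real \<Rightarrow> real^'m \<Rightarrow> bool" where
  "descent_cond f g A L w \<longleftrightarrow>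
     neg_dual_fun f g A (p_map f g A L w) \<le> Q_fun f g A L (p_map f g A L w) w"

definition T_sum :: "(nat \<Rightarrow> real) \<Rightarrow> nat \<Rightarrow> real" where
  "T_sum t k = (\<Sum>i\<le>k. t i)"

definition GFDPG ::
    "(real^'n \<Rightarrow> ereal) \<Rightarrow> (real^'m \<Rightarrow> ereal) \<Rightarrow> real^'n^'m \<Rightarrow> (nat \<Rightarrow> real) \<Rightarrow> (nat \<Rightarrow> real)
      \<Rightarrow> (nat \<Rightarrow> real^'m) \<Rightarrow> (nat \<Rightarrow> real^'m) \<Rightarrow> bool" where
  "GFDPG f g A t L y w \<longleftrightarrow>
     L 0 > 0 \<and> y 0 = w 0 \<and> 0 < t 0 \<and> t 0 \<le> 1 \<and>
     (\<forall>k\<ge>1.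
        L (k - 1) \<le> L k \<and>
        descent_cond f g A (L k) (w (k - 1)) \<and>
        y k = p_map f g A (L k) (w (k - 1)) \<and>
        t k > 0 \<and> (t k)\<^sup>2 \<le> T_sum t k \<and>
        w k = y k
          + ((T_sum t (k - 1) - t (k - 1)) * t k / (t (k - 1) * T_sum t k)) *\<^sub>R (y k - y (k - 1))
          + (((t (k - 1))\<^sup>2 - T_sum t (k - 1)) * t k / (t (k - 1) * T_sum t k))
              *\<^sub>R (y k - w (k - 1)))"

end

theory Submission
  imports Defs
begin

text \<open>
  Since \<open>f\<close> is closed and strongly convex, \<open>F\<close> is finite and differentiable; every step
  \<open>p = p\<^sub>L(w)\<close> satisfying the descent condition then fulfils, with \<open>q\<close> denoting the
  negated dual function,
  \<open>q(p) + L/2 (\<parallel>p - x\<parallel>\<^sup>2 - \<parallel>w - x\<parallel>\<^sup>2) \<le> q(x)\<close> for all \<open>x\<close>.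
  Combining this inequality at \<open>x = y\<^sub>k\<close> (weight \<open>T\<^sub>k - t\<^sub>k\<close>) and at the optimum
  (weight \<open>t\<^sub>k\<close>), the vectors \<open>u\<^sub>k = (T\<^sub>k w\<^sub>k - (T\<^sub>k - t\<^sub>k) y\<^sub>k) / t\<^sub>k\<close> telescope, because
  \<open>u\<^sub>k\<^sub>+\<^sub>1 = u\<^sub>k + t\<^sub>k (y\<^sub>k\<^sub>+\<^sub>1 - w\<^sub>k)\<close>. This bounds
  \<open>\<Sum>\<^sub>i (T\<^sub>i - t\<^sub>i\<^sup>2) \<parallel>y\<^sub>i\<^sub>+\<^sub>1 - w\<^sub>i\<parallel>\<^sup>2\<close> by the squared initial distance, and for
  \<open>t\<^sub>i = (i + a) / a\<close> the weights of the first \<open>k \<ge> 2\<close> terms sum to at least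
  \<open>(a - 2) k\<^sup>3 / (6 a\<^sup>2)\<close>. The extra step from \<open>y\<^sub>k\<close> only enlarges the set over which
  the minimum is taken, so nothing about it has to be known.
\<close>

section \<open>Closed and strongly convex extended-real functions\<close>

text \<open>Sublevel sets at real levels are slices of the closed epigraph. Those above the infimum
  are nested and each meets \<open>K\<close>, so compactness gives a point common to all of
  them.\<close>

lemma closed_fun_attains_inf:
  fixes h :: "'a::t2_space \<Rightarrow> ereal"
  assumes "compact K" "K \<noteq> {}" and h: "closed_fun h"
  obtains x where "x \<in> K" "\<And>z. z \<in> K \<Longrightarrow> h x \<le> h z"
proof -
  define I where "I = (INF z\<in>K. h z)"
  define C where "C r = {x. h x \<le> ereal r}" for r
  have closed_C: "closed (C r)" for r
  proof -
    have "C r = (\<lambda>x. (x, r)) -` ereal_epigraph h"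
      by (auto simp: C_def ereal_epigraph_def)
    moreover have "closed ((\<lambda>x. (x, r)) -` ereal_epigraph h)"
      using h by (intro continuous_closed_vimage continuous_intros) (auto simp: closed_fun_def)
    ultimately show ?thesis by simp
  qed
  have "K \<inter> \<Inter> (C ` {r. I < ereal r}) \<noteq> {}"
  proof (rule compact_imp_fip)
    show "compact K" by fact
  next
    fix S assume "S \<in> C ` {r. I < ereal r}"
    then show "closed S" using closed_C by auto
  next
    fix \<F> assume "finite \<F>" and "\<F> \<subseteq> C ` {r. I < ereal r}"
    then obtain R where R: "finite R" "R \<subseteq> {r. I < ereal r}" "\<F> = C ` R"
      by (meson finite_subset_image)
    show "K \<inter> \<Inter> \<F> \<noteq> {}"
    proof (cases "R = {}")
      case True
      with R \<open>K \<noteq> {}\<close> show ?thesis by auto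
    next
      case False
      \<comment> \<open>By nesting, a point of the sublevel set at the smallest level lies in all
        the others.\<close>
      then have "Min R \<in> R" using R by simp
      then have "I < ereal (Min R)" using R by auto
      then obtain z where z: "z \<in> K" "h z < ereal (Min R)"
        unfolding I_def by (auto simp: INF_less_iff)
      have "z \<in> C r" if "r \<in> R" for r
        using z R that by (auto simp: C_def intro!: order.trans[OF less_imp_le[OF z(2)]])
      with z R show ?thesis by auto
    qed
  qed
  then obtain x where x: "x \<in> K" "\<And>r. I < ereal r \<Longrightarrow> h x \<le> ereal r"
    by (auto simp: C_def)
  have "h x \<le> I"
    using x(2) by (metis ereal_dense2 leD le_less_linear less_le_trans order_less_imp_le)
  then have "h x \<le> h z" if "z \<in> K" for z
    using that by (auto simp: I_def intro: order.trans INF_lower)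
  with x show ?thesis using that by blast
qed

text \<open>The new epigraph is the preimage of the old one under the continuous shear that lowers
  the height over \<open>x\<close> by \<open>\<phi> x\<close>.\<close>

lemma closed_fun_add_continuous:
  fixes h :: "'a::t2_space \<Rightarrow> ereal"
  assumes "closed_fun h" "continuous_on UNIV \<phi>"
  shows "closed_fun (\<lambda>x. h x + ereal (\<phi> x))"
proof -
  have "(h x + ereal (\<phi> x) \<le> ereal r) = (h x \<le> ereal (r - \<phi> x))" for x r
    by (cases "h x") auto
  then have "ereal_epigraph (\<lambda>x. h x + ereal (\<phi> x)) =
      (\<lambda>p. (fst p, snd p - \<phi> (fst p))) -` ereal_epigraph h"
    by (auto simp: ereal_epigraph_def)
  moreover have "continuous_on UNIV (\<lambda>p. (fst p, snd p - \<phi> (fst p)))"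
    by (intro continuous_on_Pair continuous_on_diff continuous_on_compose2[OF assms(2)]
      continuous_on_fst continuous_on_snd continuous_on_id) simp
  then have "closed ((\<lambda>p. (fst p, snd p - \<phi> (fst p))) -` ereal_epigraph h)"
    using assms(1) unfolding closed_fun_def by (rule closed_vimage[rotated])
  ultimately show ?thesis by (simp add: closed_fun_def)
qed

lemma strongly_convex_funD:
  assumes "strongly_convex_fun \<sigma> h" "h x = ereal b" "h z = ereal c" "0 \<le> s" "s \<le> 1"
  shows "h (s *\<^sub>R x + (1 - s) *\<^sub>R z)
    \<le> ereal (s * b + (1 - s) * c - \<sigma> / 2 * s * (1 - s) * (norm (x - z))\<^sup>2)"
  using assms(1)[unfolded strongly_convex_fun_def, rule_format, of s x z] assms(2-)
  by simp

lemma strongly_convex_fun_0_iff: "strongly_convex_fun 0 h \<longleftrightarrow> convex_fun h"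
  by (simp add: strongly_convex_fun_def convex_fun_def flip: zero_ereal_def)

lemma strongly_convex_fun_add:
  fixes h :: "'a::real_normed_vector \<Rightarrow> ereal"
  assumes h: "strongly_convex_fun \<sigma> h" "proper h"
    and \<phi>: "\<And>x z s::real. 0 \<le> s \<Longrightarrow> s \<le> 1 \<Longrightarrow>
      \<phi> (s *\<^sub>R x + (1 - s) *\<^sub>R z) \<le> s * \<phi> x + (1 - s) * \<phi> z - \<tau> / 2 * s * (1 - s) * (norm (x - z))\<^sup>2"
  shows "strongly_convex_fun (\<sigma> + \<tau>) (\<lambda>x. h x + ereal (\<phi> x))"
  unfolding strongly_convex_fun_def
proof (intro allI impI, elim conjE)
  fix x z and s :: real assume s: "0 \<le> s" "s \<le> 1"
  have fin: "h v \<noteq> -\<infinity>" for v using h(2) by (auto simp: proper_def)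
  \<comment> \<open>The endpoints are split off because \<open>0 * \<infinity> = 0\<close> in
    \<open>ereal\<close>: only for \<open>0 < s < 1\<close> does an infinite value at
    \<open>x\<close> or \<open>z\<close> make the right-hand side infinite.\<close>
  consider "s = 0" | "s = 1" | "0 < s" "s < 1" using s by linarith
  then show "h (s *\<^sub>R x + (1 - s) *\<^sub>R z) + ereal (\<phi> (s *\<^sub>R x + (1 - s) *\<^sub>R z)) \<le>
      ereal s * (h x + ereal (\<phi> x)) + ereal (1 - s) * (h z + ereal (\<phi> z)) -
      ereal ((\<sigma> + \<tau>) / 2 * s * (1 - s) * (norm (x - z))\<^sup>2)"
  proof cases
    case 3
    show ?thesis
    proof (cases "h x = \<infinity> \<or> h z = \<infinity>")
      case True
      with 3 fin[of x] fin[of z] show ?thesis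
        by (cases "h x"; cases "h z") auto
    next
      case False
      then obtain b c where bc: "h x = ereal b" "h z = ereal c"
        using fin[of x] fin[of z] by (metis ereal_cases)
      show ?thesis
        using strongly_convex_funD[OF h(1) bc s] \<phi>[OF s, of x z]
        by (cases "h (s *\<^sub>R x + (1 - s) *\<^sub>R z)") (auto simp: bc algebra_simps add_divide_distrib)
    qed
  qed (auto simp flip: zero_ereal_def one_ereal_def)
qed

lemma proper_add_real: "proper h \<Longrightarrow> proper (\<lambda>x. h x + ereal (\<phi> x))"
  by (force simp: proper_def)

text \<open>Minimality of \<open>p\<close> is tested at points of the segment towards
  \<open>x\<close>; dividing by the step \<open>s\<close> and letting \<open>s\<close> tend to 0
  removes the factor \<open>1 - s\<close>.\<close>

lemma strongly_convex_min_growth: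
  fixes h :: "'a::real_normed_vector \<Rightarrow> ereal"
  assumes h: "proper h" "strongly_convex_fun \<sigma> h" and p: "\<And>x. h p \<le> h x"
  shows "h p + ereal (\<sigma> / 2 * (norm (x - p))\<^sup>2) \<le> h x"
proof -
  obtain v where "h v \<noteq> \<infinity>" using h(1) by (auto simp: proper_def)
  then have "h p \<noteq> \<infinity>" using p[of v] by auto
  moreover have "h p \<noteq> -\<infinity>" "h x \<noteq> -\<infinity>" using h(1) by (auto simp: proper_def)
  ultimately obtain c where c: "h p = ereal c" by (cases "h p") auto
  show ?thesis
  proof (cases "h x")
    case (real b)
    have "\<sigma> / 2 * (1 - s) * (norm (x - p))\<^sup>2 \<le> b - c" if "0 < s" "s < 1" for s
    proof -
      have "ereal c \<le> ereal (s * b + (1 - s) * c - \<sigma> / 2 * s * (1 - s) * (norm (x - p))\<^sup>2)"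
        using order.trans[OF p strongly_convex_funD[OF h(2) real c]] that by (simp add: c)
      then have "s * (\<sigma> / 2 * (1 - s) * (norm (x - p))\<^sup>2) \<le> s * (b - c)"
        by (simp add: algebra_simps)
      with that show ?thesis by simp
    qed
    then have "\<forall>\<^sub>F s in at_right 0. \<sigma> / 2 * (1 - s) * (norm (x - p))\<^sup>2 \<le> b - c"
      by (auto simp: eventually_at_right_field intro!: exI[of _ 1])
    moreover have "((\<lambda>s. \<sigma> / 2 * (1 - s) * (norm (x - p))\<^sup>2) \<longlongrightarrow> \<sigma> / 2 * (1 - 0) * (norm (x - p))\<^sup>2)
        (at_right 0)"
      by (intro tendsto_intros)
    ultimately have "\<sigma> / 2 * (1 - 0) * (norm (x - p))\<^sup>2 \<le> b - c"
      using tendsto_upperbound trivial_limit_at_right_real by blast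
    then show ?thesis by (simp add: real c)
  qed (use \<open>h x \<noteq> -\<infinity>\<close> in auto)
qed

text \<open>Outside a large ball the values are at least \<open>h x0\<close>, so a minimizer over
  that compact ball is global.\<close>

lemma strongly_convex_has_min:
  fixes h :: "'a::euclidean_space \<Rightarrow> ereal"
  assumes h: "proper h" "closed_fun h" "strongly_convex_fun \<sigma> h" and "\<sigma> > 0"
  obtains p where "\<And>x. h p \<le> h x"
proof -
  have fin: "h v \<noteq> -\<infinity>" for v using h by (auto simp: proper_def)
  obtain x0 where "h x0 \<noteq> \<infinity>" using h by (auto simp: proper_def)
  then obtain c where c: "h x0 = ereal c" using fin[of x0] by (cases "h x0") auto
  obtain x1 where x1: "x1 \<in> cball x0 1" "\<And>z. z \<in> cball x0 1 \<Longrightarrow> h x1 \<le> h z"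
    by (rule closed_fun_attains_inf[OF compact_cball _ h(2), of x0 1]) auto
  have "h x1 \<le> ereal c" using x1(2)[of x0] c by simp
  then obtain m where m: "h x1 = ereal m" "m \<le> c" using fin[of x1] by (cases "h x1") auto
  \<comment> \<open>The radius solves \<open>c - \<sigma> / 2 * (R - 1) = m\<close>, so that a
    smaller value than \<open>h x0\<close> beyond it would push the unit ball below its minimum
    \<open>m\<close>.\<close>
  define R where "R = 1 + 2 * (c - m) / \<sigma>"
  have "R \<ge> 1" using m \<open>\<sigma> > 0\<close> by (simp add: R_def)
  \<comment> \<open>Scaling a far away point back to the unit ball around \<open>x0\<close>, strong convexity
     forces quadratic growth, so the sublevel set of \<open>x0\<close> is bounded.\<close>
  have far: "h x0 \<le> h x" if x: "x \<notin> cball x0 R" for x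
  proof (rule ccontr)
    assume "\<not> h x0 \<le> h x"
    then obtain b where b: "h x = ereal b" "b < c" using c fin[of x] by (cases "h x") auto
    define r where "r = norm (x - x0)"
    have r: "r > R" using x by (simp add: r_def dist_norm norm_minus_commute)
    define z where "z = (1 / r) *\<^sub>R x + (1 - 1 / r) *\<^sub>R x0"
    have "z - x0 = (1 / r) *\<^sub>R (x - x0)" by (simp add: z_def algebra_simps)
    then have "norm (z - x0) = 1" using r \<open>R \<ge> 1\<close> by (auto simp: r_def)
    then have "ereal m \<le> h z" using x1(2)[of z] m by (simp add: dist_norm norm_minus_commute)
    also have "h z \<le> ereal (1 / r * b + (1 - 1 / r) * c - \<sigma> / 2 * (1 / r) * (1 - 1 / r) * r\<^sup>2)"
      unfolding z_def r_def
      by (rule strongly_convex_funD[OF h(3) b(1) c])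
        (use r \<open>R \<ge> 1\<close> in \<open>auto simp: r_def[symmetric]\<close>)
    finally have "m \<le> 1 / r * b + (1 - 1 / r) * c - \<sigma> / 2 * (1 / r) * (1 - 1 / r) * r\<^sup>2" by simp
    also have "\<dots> = c - (c - b) / r - \<sigma> / 2 * (r - 1)"
      using r \<open>R \<ge> 1\<close> by (simp add: field_simps power2_eq_square)
    also have "\<dots> \<le> c - \<sigma> / 2 * (r - 1)" using r b \<open>R \<ge> 1\<close> by simp
    also have "\<dots> < c - \<sigma> / 2 * (R - 1)" using r \<open>\<sigma> > 0\<close> by simp
    also have "\<dots> = m" using \<open>\<sigma> > 0\<close> by (simp add: R_def field_simps)
    finally show False by simp
  qed
  obtain p where p: "p \<in> cball x0 R" "\<And>z. z \<in> cball x0 R \<Longrightarrow> h p \<le> h z"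
    using \<open>R \<ge> 1\<close> by (auto intro: closed_fun_attains_inf[OF compact_cball _ h(2), of x0 R])
  have "h p \<le> h x" for x
    using far[of x] p(2)[of x] p(2)[of x0] \<open>R \<ge> 1\<close> by (cases "x \<in> cball x0 R") auto
  then show ?thesis using that by blast
qed

lemma norm_sq_combination:
  fixes x z :: "'a::real_inner"
  shows "(norm (s *\<^sub>R x + (1 - s) *\<^sub>R z))\<^sup>2
    = s * (norm x)\<^sup>2 + (1 - s) * (norm z)\<^sup>2 - s * (1 - s) * (norm (x - z))\<^sup>2"
  unfolding power2_norm_eq_inner by (simp add: inner_simps inner_commute algebra_simps)

lemma norm_sq_combination_diff:
  fixes x z w :: "'a::real_inner"
  shows "(norm (s *\<^sub>R x + (1 - s) *\<^sub>R z - w))\<^sup>2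
    = s * (norm (x - w))\<^sup>2 + (1 - s) * (norm (z - w))\<^sup>2 - s * (1 - s) * (norm (x - z))\<^sup>2"
proof -
  have "s *\<^sub>R x + (1 - s) *\<^sub>R z - w = s *\<^sub>R (x - w) + (1 - s) *\<^sub>R (z - w)"
    by (simp add: algebra_simps)
  then show ?thesis using norm_sq_combination[of s "x - w" "z - w"] by simp
qed

section \<open>Smoothness of the conjugate of a strongly convex function, and the gradient of
  F\<close>

lemma conjugate_ge: "ereal (u \<bullet> x) - f x \<le> conjugate f u"
  unfolding conjugate_def by (rule SUP_upper) simp

text \<open>Tilting \<open>f\<close> by a linear form keeps its modulus, so the tilted function has
  a minimizer \<open>x\<close>. Its quadratic growth there is a strengthened subgradient inequality
  for \<open>f\<close> with slope \<open>u\<close>.\<close>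

lemma conjugate_attained:
  fixes f :: "'a::euclidean_space \<Rightarrow> ereal"
  assumes f: "proper f" "closed_fun f" "strongly_convex_fun \<sigma> f" and "\<sigma> > 0"
  obtains x c where "f x = ereal c" "conjugate f u = ereal (u \<bullet> x - c)"
    "\<And>z. ereal (c + u \<bullet> (z - x) + \<sigma> / 2 * (norm (z - x))\<^sup>2) \<le> f z"
proof -
  define h where "h z = f z + ereal (- (u \<bullet> z))" for z
  have h: "proper h" "closed_fun h"
    unfolding h_def by (auto intro!: f proper_add_real closed_fun_add_continuous continuous_intros)
  have "strongly_convex_fun (\<sigma> + 0) h"
    unfolding h_def by (rule strongly_convex_fun_add[OF f(3,1)]) (simp add: inner_simps)
  then have sc: "strongly_convex_fun \<sigma> h" by simp
  obtain x where x: "\<And>z. h x \<le> h z"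
    using strongly_convex_has_min[OF h sc \<open>\<sigma> > 0\<close>] by blast
  have fin: "f z \<noteq> -\<infinity>" for z using f by (auto simp: proper_def)
  obtain v where "f v \<noteq> \<infinity>" using f by (auto simp: proper_def)
  then have "f x \<noteq> \<infinity>" using x[of v] by (auto simp: h_def)
  then obtain c where c: "f x = ereal c" using fin[of x] by (cases "f x") auto
  have growth: "ereal (c + u \<bullet> (z - x) + \<sigma> / 2 * (norm (z - x))\<^sup>2) \<le> f z" for z
    using strongly_convex_min_growth[OF h(1) sc x, of z] fin[of z]
    by (cases "f z") (auto simp: h_def c inner_simps)
  have "ereal (u \<bullet> z) - f z \<le> ereal (u \<bullet> x - c)" for z
    using x[of z] fin[of z] by (cases "f z") (auto simp: h_def c)
  then have "conjugate f u \<le> ereal (u \<bullet> x - c)"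
    unfolding conjugate_def by (auto intro: SUP_least)
  moreover have "ereal (u \<bullet> x - c) \<le> conjugate f u" using conjugate_ge[of u x f] c by simp
  ultimately show ?thesis using that c growth by (meson antisym)
qed

text \<open>\<open>X u\<close> is the maximizer defining the conjugate, hence its gradient. Testing
  the supremum at \<open>v\<close> with \<open>X u\<close> gives the lower bound; growth of
  \<open>f\<close> from \<open>X u\<close> to \<open>X v\<close> and Young's inequality give the
  upper one.\<close>

lemma conjugate_quadratic_bounds:
  fixes f :: "'a::euclidean_space \<Rightarrow> ereal"
  assumes f: "proper f" "closed_fun f" "strongly_convex_fun \<sigma> f" and "\<sigma> > 0"
  obtains \<phi> X where "\<And>u. conjugate f u = ereal (\<phi> u)"
    "\<And>u v. \<phi> u + (v - u) \<bullet> X u \<le> \<phi> v"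
    "\<And>u v. \<phi> v \<le> \<phi> u + (v - u) \<bullet> X u + (norm (v - u))\<^sup>2 / (2 * \<sigma>)"
proof -
  have "\<exists>x c. f x = ereal c \<and> conjugate f u = ereal (u \<bullet> x - c) \<and>
     (\<forall>z. ereal (c + u \<bullet> (z - x) + \<sigma> / 2 * (norm (z - x))\<^sup>2) \<le> f z)" for u
    by (rule conjugate_attained[OF assms, of u]) blast
  then obtain X c where X: "\<And>u. f (X u) = ereal (c u)"
    "\<And>u. conjugate f u = ereal (u \<bullet> X u - c u)"
    "\<And>u z. ereal (c u + u \<bullet> (z - X u) + \<sigma> / 2 * (norm (z - X u))\<^sup>2) \<le> f z"
    by metis
  define \<phi> where "\<phi> u = u \<bullet> X u - c u" for u
  have lower: "\<phi> u + (v - u) \<bullet> X u \<le> \<phi> v" for u v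
    using conjugate_ge[of v "X u" f] by (simp add: X \<phi>_def inner_simps)
  have upper: "\<phi> v \<le> \<phi> u + (v - u) \<bullet> X u + (norm (v - u))\<^sup>2 / (2 * \<sigma>)" for u v
  proof -
    define d where "d = X v - X u"
    have "c u + u \<bullet> d + \<sigma> / 2 * (norm d)\<^sup>2 \<le> c v"
      using X(3)[of u "X v"] by (simp add: X(1) d_def)
    moreover have "(v - u) \<bullet> d \<le> \<sigma> / 2 * (norm d)\<^sup>2 + (norm (v - u))\<^sup>2 / (2 * \<sigma>)"
    proof -
      \<comment> \<open>This square, expanded, is Young's inequality balanced so that the
        \<open>d\<close> term matches the growth of \<open>f\<close>.\<close>
      have "0 \<le> (norm (\<sigma> *\<^sub>R d - (v - u)))\<^sup>2 / (2 * \<sigma>)" using \<open>\<sigma> > 0\<close> by simp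
      also have "(norm (\<sigma> *\<^sub>R d - (v - u)))\<^sup>2
          = \<sigma>\<^sup>2 * (norm d)\<^sup>2 - 2 * \<sigma> * ((v - u) \<bullet> d) + (norm (v - u))\<^sup>2"
        unfolding power2_norm_eq_inner
          by (simp add: inner_simps inner_commute algebra_simps power2_eq_square[of \<sigma>])
      also have "\<dots> / (2 * \<sigma>) = \<sigma> / 2 * (norm d)\<^sup>2 - (v - u) \<bullet> d + (norm (v - u))\<^sup>2 / (2 * \<sigma>)"
        using \<open>\<sigma> > 0\<close> by (simp add: field_simps power2_eq_square)
      finally show ?thesis by simp
    qed
    ultimately show ?thesis by (simp add: \<phi>_def d_def inner_simps)
  qed
  show ?thesis by (rule that[OF _ lower upper]) (simp add: X(2) \<phi>_def)
qed

lemma gderiv_quadratic_bound: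
  fixes h :: "'a::real_inner \<Rightarrow> real"
  assumes "\<And>v. \<bar>h v - h x - (v - x) \<bullet> D\<bar> \<le> C * (norm (v - x))\<^sup>2"
  shows "GDERIV h x :> D"
proof -
  have bound: "norm (h v - h x - (v - x) \<bullet> D) / norm (v - x) \<le> C * norm (v - x)" for v
  proof (cases "v = x")
    case False
    then show ?thesis using assms[of v]
      by (simp add: divide_le_eq power2_eq_square mult.assoc)
  qed simp
  have "((\<lambda>v. C * norm (v - x)) \<longlongrightarrow> C * norm (x - x)) (at x)"
    by (intro tendsto_intros)
  then have "((\<lambda>v. C * norm (v - x)) \<longlongrightarrow> 0) (at x)" by simp
  moreover have "\<forall>\<^sub>F v in at x. norm (norm (h v - h x - (v - x) \<bullet> D) / norm (v - x)) \<le> C * norm (v - x)"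
    using bound by (intro always_eventually allI) simp
  ultimately have "((\<lambda>v. norm (h v - h x - (v - x) \<bullet> D) / norm (v - x)) \<longlongrightarrow> 0) (at x)"
    by (rule Lim_null_comparison[rotated])
  then show ?thesis
    unfolding gderiv_def has_derivative_iff_norm by (auto intro: bounded_linear_inner_left)
qed

lemma gradient_eqI: "GDERIV h x :> D \<Longrightarrow> gradient h x = D"
proof -
  assume D: "GDERIV h x :> D"
  have "D' = D" if "GDERIV h x :> D'" for D'
  proof -
    have "(\<lambda>v. v \<bullet> D') = (\<lambda>v. v \<bullet> D)"
      using D that unfolding gderiv_def by (rule has_derivative_unique[rotated])
    then have "v \<bullet> D' = v \<bullet> D" for v by metis
    then show ?thesis by (metis inner_commute vector_eq_rdot)
  qed
  with D show ?thesis unfolding gradient_def by blast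
qed

text \<open>The bounds for the conjugate pull back along the transpose of \<open>A\<close>. The
  upper one identifies the gradient as \<open>A *v X (B w)\<close>; later majorization comes from
  the descent condition, so the subgradient inequality is what is passed on.\<close>

lemma F_fun_real_gradient:
  fixes f :: "real^'n \<Rightarrow> ereal" and A :: "real^'n^'m"
  assumes f: "proper f" "closed_fun f" "strongly_convex_fun \<sigma> f" and "\<sigma> > 0"
  obtains \<Phi> where "\<And>y. F_fun f A y = ereal (\<Phi> y)"
    "\<And>w y. \<Phi> w + (y - w) \<bullet> gradient (\<lambda>v. real_of_ereal (F_fun f A v)) w \<le> \<Phi> y"
proof -
  obtain \<phi> X where conj: "\<And>u. conjugate f u = ereal (\<phi> u)"
    and lower: "\<And>u v. \<phi> u + (v - u) \<bullet> X u \<le> \<phi> v"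
    and upper: "\<And>u v. \<phi> v \<le> \<phi> u + (v - u) \<bullet> X u + (norm (v - u))\<^sup>2 / (2 * \<sigma>)"
    using conjugate_quadratic_bounds[OF assms] by blast
  define B where "B y = transpose A *v y" for y
  define \<Phi> where "\<Phi> y = \<phi> (B y)" for y
  have F: "F_fun f A y = ereal (\<Phi> y)" for y
    by (simp add: F_fun_def conj \<Phi>_def B_def)
  have adj: "B y \<bullet> x = y \<bullet> (A *v x)" for y x
    by (simp add: B_def dot_lmul_matrix)
  have Bd: "B y - B w = B (y - w)" for y w
    by (simp add: B_def matrix_vector_mult_diff_distrib)
  have bl: "bounded_linear B"
    unfolding B_def by (rule matrix_vector_mul_bounded_linear)
  have sub: "\<Phi> w + (y - w) \<bullet> (A *v X (B w)) \<le> \<Phi> y" for w y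
    using lower[of "B w" "B y"] by (simp add: Bd adj \<Phi>_def)
  have "\<bar>\<Phi> y - \<Phi> w - (y - w) \<bullet> (A *v X (B w))\<bar> \<le> (onorm B)\<^sup>2 / (2 * \<sigma>) * (norm (y - w))\<^sup>2" for w y
  proof -
    have "(norm (B (y - w)))\<^sup>2 \<le> (onorm B * norm (y - w))\<^sup>2"
      using onorm[OF bl] by (intro power_mono) auto
    then have "(norm (B (y - w)))\<^sup>2 / (2 * \<sigma>) \<le> (onorm B)\<^sup>2 / (2 * \<sigma>) * (norm (y - w))\<^sup>2"
      using \<open>\<sigma> > 0\<close> by (simp add: divide_right_mono power_mult_distrib)
    then show ?thesis
      using sub[of w y] upper[of "B y" "B w"] by (simp add: Bd adj \<Phi>_def)
  qed
  then have "gradient \<Phi> w = A *v X (B w)" for w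
    by (intro gradient_eqI gderiv_quadratic_bound)
  with sub F show ?thesis by (intro that) auto
qed

section \<open>Regularity of the conjugate of g and of G\<close>

lemma conjugate_convex_fun:
  assumes "proper g"
  shows "convex_fun (conjugate g)"
  unfolding convex_fun_def conjugate_def
proof (intro allI impI SUP_least, elim conjE)
  fix u v z and s :: real assume s: "0 \<le> s" "s \<le> 1"
  let ?S = "\<lambda>u. SUP x. ereal (u \<bullet> x) - g x"
  have fin: "g z \<noteq> -\<infinity>" using assms by (auto simp: proper_def)
  have "ereal ((s *\<^sub>R u + (1 - s) *\<^sub>R v) \<bullet> z) - g z
      = ereal s * (ereal (u \<bullet> z) - g z) + ereal (1 - s) * (ereal (v \<bullet> z) - g z)"
    using fin s by (cases "g z"; cases "s = 0"; cases "s = 1")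
      (auto simp: inner_simps algebra_simps zero_ereal_def[symmetric] one_ereal_def[symmetric])
  also have "\<dots> \<le> ereal s * ?S u + ereal (1 - s) * ?S v"
    using s by (intro add_mono ereal_mult_left_mono SUP_upper) auto
  finally show "ereal ((s *\<^sub>R u + (1 - s) *\<^sub>R v) \<bullet> z) - g z \<le> ereal s * ?S u + ereal (1 - s) * ?S v" .
qed

text \<open>The epigraph is an intersection of closed half-spaces, one for each finite value of
  \<open>g\<close>.\<close>

lemma conjugate_closed_fun:
  assumes "proper g"
  shows "closed_fun (conjugate g)"
proof -
  have "ereal_epigraph (conjugate g) = (\<Inter>x. {p. ereal (fst p \<bullet> x) - g x \<le> ereal (snd p)})"
    by (auto simp: ereal_epigraph_def conjugate_def SUP_le_iff)
  moreover have "closed {p. ereal (fst p \<bullet> x) - g x \<le> ereal (snd p)}" for x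
  proof (cases "g x")
    case (real b)
    then show ?thesis by (auto intro!: closed_Collect_le continuous_intros)
  qed (use assms in \<open>auto simp: proper_def\<close>)
  ultimately show ?thesis by (auto simp: closed_fun_def)
qed

lemma conjugate_proper:
  fixes g :: "'a::euclidean_space \<Rightarrow> ereal"
  assumes g: "proper g" "closed_fun g" "convex_fun g"
  shows "proper (conjugate g)"
proof -
  \<comment> \<open>The minimizer \<open>x\<close> of \<open>g + \<parallel>\<cdot>\<parallel>\<^sup>2 / 2\<close> yields the affine minorant of \<open>g\<close> with slope \<open>-x\<close>.\<close>
  define h where "h z = g z + ereal ((norm z)\<^sup>2 / 2)" for z
  have h: "proper h" "closed_fun h"
    unfolding h_def by (auto intro!: g proper_add_real closed_fun_add_continuous continuous_intros)
  have "strongly_convex_fun (0 + 1) h"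
    unfolding h_def
  proof (rule strongly_convex_fun_add)
    show "(norm (s *\<^sub>R x + (1 - s) *\<^sub>R z))\<^sup>2 / 2
      \<le> s * ((norm x)\<^sup>2 / 2) + (1 - s) * ((norm z)\<^sup>2 / 2) - 1 / 2 * s * (1 - s) * (norm (x - z))\<^sup>2"
      for x z :: 'a and s :: real
      unfolding norm_sq_combination by (simp add: field_simps)
  qed (simp_all add: strongly_convex_fun_0_iff g)
  then have "strongly_convex_fun 1 h" by simp
  \<comment> \<open>Slope 0 makes \<open>x\<close> a minimizer of \<open>h\<close> with quadratic
    growth. The squares of \<open>norm z\<close> then cancel, leaving an affine minorant of
    \<open>g\<close>.\<close>
  then obtain x c where "h x = ereal c" "conjugate h 0 = ereal (0 \<bullet> x - c)"
    and x: "\<And>z. ereal (c + 0 \<bullet> (z - x) + 1 / 2 * (norm (z - x))\<^sup>2) \<le> h z"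
    by (rule conjugate_attained[OF h _ zero_less_one, of 0]) (rule that)
  have "ereal (- x \<bullet> z) - g z \<le> ereal (- c - (norm x)\<^sup>2 / 2)" for z
  proof -
    have "g z \<noteq> -\<infinity>" using g by (auto simp: proper_def)
    moreover have "(norm (z - x))\<^sup>2 = (norm z)\<^sup>2 - 2 * (x \<bullet> z) + (norm x)\<^sup>2"
      by (simp add: power2_norm_eq_inner inner_simps inner_commute)
    ultimately show ?thesis using x[of z] by (cases "g z") (auto simp: h_def field_simps)
  qed
  then have "conjugate g (- x) \<le> ereal (- c - (norm x)\<^sup>2 / 2)"
    unfolding conjugate_def by (intro SUP_least)
  then have "conjugate g (- x) \<noteq> \<infinity>" by auto
  moreover obtain v where v: "g v \<noteq> \<infinity>" "g v \<noteq> -\<infinity>" using g by (auto simp: proper_def)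
  then have "conjugate g u \<noteq> -\<infinity>" for u using conjugate_ge[of u v g] by (cases "g v") auto
  ultimately show ?thesis by (auto simp: proper_def)
qed

lemma G_fun_proper_closed_convex:
  fixes g :: "real^'m \<Rightarrow> ereal"
  assumes g: "proper g" "closed_fun g" "convex_fun g"
  shows "proper (G_fun g)" "closed_fun (G_fun g)" "convex_fun (G_fun g)"
proof -
  show "proper (G_fun g)"
    using conjugate_proper[OF g] unfolding proper_def G_fun_def by (metis minus_minus)
  have "ereal_epigraph (G_fun g) = (\<lambda>p. (- fst p, snd p)) -` ereal_epigraph (conjugate g)"
    by (auto simp: ereal_epigraph_def G_fun_def)
  moreover have "closed ((\<lambda>p. (- fst p, snd p)) -` ereal_epigraph (conjugate g))"
    using conjugate_closed_fun[OF g(1)]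
    by (intro continuous_closed_vimage continuous_intros) (auto simp: closed_fun_def)
  ultimately show "closed_fun (G_fun g)" by (simp add: closed_fun_def)
  show "convex_fun (G_fun g)"
    unfolding convex_fun_def G_fun_def
  proof (intro allI impI)
    fix x y and s :: real assume "0 \<le> s \<and> s \<le> 1"
    then show "conjugate g (- (s *\<^sub>R x + (1 - s) *\<^sub>R y))
        \<le> ereal s * conjugate g (- x) + ereal (1 - s) * conjugate g (- y)"
      using conjugate_convex_fun[OF g(1), unfolded convex_fun_def, rule_format, of s "- x" "- y"]
      by (simp add: algebra_simps)
  qed
qed

section \<open>One proximal gradient step\<close>

text \<open>The model in \<open>y\<close> is strongly convex with modulus \<open>L\<close>, so it
  grows quadratically around its minimizer \<open>p\<close>. The descent condition compares model
  and objective at \<open>p\<close>, the subgradient inequality at \<open>x\<close>.\<close>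

lemma proximal_gradient_inequality:
  fixes f :: "real^'n \<Rightarrow> ereal" and g :: "real^'m \<Rightarrow> ereal" and A :: "real^'n^'m"
  assumes F: "\<And>y. F_fun f A y = ereal (\<Phi> y)"
    and sub: "\<And>w y. \<Phi> w + (y - w) \<bullet> gradient (\<lambda>v. real_of_ereal (F_fun f A v)) w \<le> \<Phi> y"
    and g: "proper g" "closed_fun g" "convex_fun g"
    and "L > 0" "descent_cond f g A L w" and p: "p = p_map f g A L w"
    and x: "neg_dual_fun f g A x = ereal b"
  obtains c where "neg_dual_fun f g A p = ereal c"
    "c + L / 2 * ((norm (p - x))\<^sup>2 - (norm (w - x))\<^sup>2) \<le> b"
proof -
  note G = G_fun_proper_closed_convex[OF g]
  let ?D = "gradient (\<lambda>v. real_of_ereal (F_fun f A v)) w"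
  define \<psi> where "\<psi> y = \<Phi> w + (y - w) \<bullet> ?D + L / 2 * (norm (y - w))\<^sup>2" for y
  have Q: "Q_fun f g A L y w = G_fun g y + ereal (\<psi> y)" for y
    by (simp add: Q_fun_def F \<psi>_def add.commute)
  define h where "h y = Q_fun f g A L y w" for y
  have h: "proper h" "closed_fun h"
    unfolding h_def Q \<psi>_def
    by (auto intro!: G proper_add_real closed_fun_add_continuous continuous_intros)
  have "strongly_convex_fun (0 + L) h"
    unfolding h_def Q
  proof (rule strongly_convex_fun_add)
    show "\<psi> (s *\<^sub>R x + (1 - s) *\<^sub>R z)
      \<le> s * \<psi> x + (1 - s) * \<psi> z - L / 2 * s * (1 - s) * (norm (x - z))\<^sup>2" for x z and s :: real
      unfolding \<psi>_def norm_sq_combination_diff by (simp add: inner_simps field_simps)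
  qed (simp_all add: strongly_convex_fun_0_iff G)
  then have sc: "strongly_convex_fun L h" by simp
  \<comment> \<open>Existence of some minimizer ensures that the choice made by
    \<open>arg_min\<close> is one.\<close>
  obtain p' where "\<And>y. h p' \<le> h y"
    using strongly_convex_has_min[OF h sc \<open>L > 0\<close>] by blast
  then have "is_arg_min h (\<lambda>_. True) p'" by (simp add: is_arg_min_def not_less)
  then have "is_arg_min h (\<lambda>_. True) p"
    unfolding p p_map_def arg_min_def h_def by (rule someI)
  then have "h p \<le> h y" for y by (auto simp: is_arg_min_def not_less)
  then have growth: "h p + ereal (L / 2 * (norm (x - p))\<^sup>2) \<le> h x"
    by (rule strongly_convex_min_growth[OF h(1) sc])
  have nd: "neg_dual_fun f g A y = ereal (\<Phi> y) + G_fun g y" for y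
    using G(1) by (cases "G_fun g y") (auto simp: neg_dual_fun_def dual_fun_def F proper_def)
  have Gx: "G_fun g x = ereal (b - \<Phi> x)" using x by (cases "G_fun g x") (auto simp: nd)
  have "G_fun g p \<noteq> -\<infinity>" using G(1) by (auto simp: proper_def)
  \<comment> \<open>Finiteness at \<open>p\<close> is inherited from \<open>x\<close>, since
    \<open>growth\<close> bounds the model at \<open>p\<close> by its finite value at
    \<open>x\<close>.\<close>
  then obtain d where d: "G_fun g p = ereal d"
    using growth by (cases "G_fun g p") (auto simp: h_def Q Gx)
  have "\<Phi> p \<le> \<psi> p"
    using \<open>descent_cond f g A L w\<close> unfolding descent_cond_def p[symmetric] by (simp add: nd Q d add.commute)
  moreover have "d + \<psi> p + L / 2 * (norm (x - p))\<^sup>2 \<le> b - \<Phi> x + \<psi> x"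
    using growth by (simp add: h_def Q d Gx)
  moreover have "\<psi> x \<le> \<Phi> x + L / 2 * (norm (x - w))\<^sup>2" using sub[of w x] by (simp add: \<psi>_def)
  ultimately have "\<Phi> p + d + L / 2 * (norm (x - p))\<^sup>2 \<le> b + L / 2 * (norm (x - w))\<^sup>2"
    by linarith
  then have "(\<Phi> p + d) + L / 2 * ((norm (p - x))\<^sup>2 - (norm (w - x))\<^sup>2) \<le> b"
    by (simp add: norm_minus_commute right_diff_distrib)
  then show ?thesis using that d by (simp add: nd)
qed

section \<open>Telescoping potential of the accelerated method\<close>

text \<open>The potential couples the weighted optimality gap with the squared distance from
  \<open>u\<close> to \<open>xs\<close>; what it loses at each step pays for the displacement terms
  in the sum. \<open>D\<close> stands for the effective domain of the objective.\<close>

lemma accelerated_potential: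
  fixes y w :: "nat \<Rightarrow> 'a::real_inner" and t T L :: "nat \<Rightarrow> real" and q :: "'a \<Rightarrow> real"
  assumes descent: "\<And>n x. x \<in> D \<Longrightarrow>
      q (y (Suc n)) + L (Suc n) / 2 * ((norm (y (Suc n) - x))\<^sup>2 - (norm (w n - x))\<^sup>2) \<le> q x"
    and dom: "\<And>n. y (Suc n) \<in> D" "xs \<in> D" and opt: "\<And>x. x \<in> D \<Longrightarrow> q xs \<le> q x"
    and t: "\<And>n. 0 < t n" and T: "T 0 = t 0" "\<And>n. T (Suc n) = T n + t (Suc n)"
    and L: "\<And>n. 0 < L n" "\<And>n. L n \<le> L (Suc n)" and init: "y 0 = w 0"
    and w: "\<And>n. w (Suc n) = y (Suc n)
      + ((T n - t n) * t (Suc n) / (t n * T (Suc n))) *\<^sub>R (y (Suc n) - y n)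
      + (((t n)\<^sup>2 - T n) * t (Suc n) / (t n * T (Suc n))) *\<^sub>R (y (Suc n) - w n)"
  shows "(\<Sum>i\<le>n. (T i - (t i)\<^sup>2) * (norm (y (Suc i) - w i))\<^sup>2) \<le> (norm (y 0 - xs))\<^sup>2"
proof -
  define u where "u n = (1 / t n) *\<^sub>R (T n *\<^sub>R w n - (T n - t n) *\<^sub>R y n)" for n
  define d where "d n = y (Suc n) - w n" for n
  have T_pos: "0 < T n" for n by (induction n) (use T t in \<open>auto intro: add_pos_pos\<close>)
  have T_ge: "t n \<le> T n" for n by (cases n) (use T T_pos in \<open>auto intro: less_imp_le\<close>)
  have tu: "t n *\<^sub>R u n = T n *\<^sub>R w n - (T n - t n) *\<^sub>R y n" for n
    using t[of n] by (simp add: u_def)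
  \<comment> \<open>Both extrapolation coefficients are designed for this recursion: since
    \<open>T (Suc n) - t (Suc n) = T n\<close>, clearing denominators leaves only \<open>u n\<close>
    and a multiple of \<open>d n\<close>.\<close>
  have u_Suc: "u (Suc n) = u n + t n *\<^sub>R d n" for n
  proof -
    let ?s = "t n" and ?r = "t (Suc n)" and ?T = "T n"
    have pos: "?s > 0" "?r > 0" "T (Suc n) > 0" using t T_pos by auto
    have "(?s * T (Suc n)) *\<^sub>R w (Suc n) = (?s * T (Suc n)) *\<^sub>R y (Suc n)
        + ((?T - ?s) * ?r) *\<^sub>R (y (Suc n) - y n) + ((?s\<^sup>2 - ?T) * ?r) *\<^sub>R d n"
      using pos by (simp add: w scaleR_add_right d_def)
    then have "?s *\<^sub>R (?r *\<^sub>R u (Suc n)) = ?r *\<^sub>R ((?s\<^sup>2) *\<^sub>R d n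
        + (?s *\<^sub>R y (Suc n) + (?T - ?s) *\<^sub>R (y (Suc n) - y n) - ?T *\<^sub>R d n))"
      by (simp add: tu T(2) algebra_simps)
    also have "?s *\<^sub>R y (Suc n) + (?T - ?s) *\<^sub>R (y (Suc n) - y n) - ?T *\<^sub>R d n = ?s *\<^sub>R u n"
      by (simp add: tu d_def algebra_simps)
    also have "?r *\<^sub>R ((?s\<^sup>2) *\<^sub>R d n + ?s *\<^sub>R u n) = ?s *\<^sub>R (?r *\<^sub>R (u n + ?s *\<^sub>R d n))"
      by (simp add: algebra_simps power2_eq_square)
    finally show ?thesis using pos by simp
  qed
  have descent': "q (y (Suc n)) + L (Suc n) / 2 * ((norm (d n))\<^sup>2 + 2 * (d n \<bullet> (w n - x))) \<le> q x"
    if "x \<in> D" for n x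
  proof -
    have "(norm (y (Suc n) - x))\<^sup>2 - (norm (w n - x))\<^sup>2 = (norm (d n))\<^sup>2 + 2 * (d n \<bullet> (w n - x))"
      unfolding power2_norm_eq_inner d_def by (simp add: inner_simps inner_commute)
    then show ?thesis using descent[OF that, of n] by simp
  qed
  define \<delta> where "\<delta> n = q (y n) - q xs" for n
  have \<delta>_nonneg: "0 \<le> \<delta> (Suc n)" for n using opt[OF dom(1)] by (simp add: \<delta>_def)
  \<comment> \<open>\<open>y 0\<close> need not lie in the domain, but its weight \<open>T 0 - t 0\<close> vanishes.\<close>
  have step: "2 / L (Suc n) * (T n * \<delta> (Suc n)) + (norm (u (Suc n) - xs))\<^sup>2
      + (T n - (t n)\<^sup>2) * (norm (d n))\<^sup>2
      \<le> 2 / L (Suc n) * ((T n - t n) * \<delta> n) + (norm (u n - xs))\<^sup>2" for n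
  proof -
    define l where "l = L (Suc n) / 2"
    have "l > 0" using L(1)[of "Suc n"] by (simp add: l_def)
    note descent' = descent'[where n = n, folded l_def]
    have "(T n - t n) * (q (y (Suc n)) + l * ((norm (d n))\<^sup>2 + 2 * (d n \<bullet> (w n - y n))))
        \<le> (T n - t n) * q (y n)"
    proof (cases n)
      case (Suc m)
      then show ?thesis
        using descent'[OF dom(1), of m] T_ge[of n] by (intro mult_left_mono) auto
    qed (simp add: T)
    moreover have "t n * (q (y (Suc n)) + l * ((norm (d n))\<^sup>2 + 2 * (d n \<bullet> (w n - xs)))) \<le> t n * q xs"
      using descent'[OF dom(2)] t[of n] by (intro mult_left_mono) auto
    ultimately have "T n * q (y (Suc n)) + l * (T n * (norm (d n))\<^sup>2
        + 2 * (d n \<bullet> ((T n - t n) *\<^sub>R (w n - y n) + t n *\<^sub>R (w n - xs))))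
        \<le> (T n - t n) * q (y n) + t n * q xs"
      by (simp add: inner_simps algebra_simps)
    also have "(T n - t n) *\<^sub>R (w n - y n) + t n *\<^sub>R (w n - xs) = t n *\<^sub>R (u n - xs)"
      by (simp add: tu scaleR_diff_right algebra_simps)
    finally have "T n * \<delta> (Suc n) + l * (T n * (norm (d n))\<^sup>2 + 2 * t n * (d n \<bullet> (u n - xs)))
        \<le> (T n - t n) * \<delta> n"
      by (simp add: \<delta>_def algebra_simps)
    note weighted = this
    \<comment> \<open>Trading the cross term for the change in distance costs
      \<open>(t n)\<^sup>2\<close> times the squared step, which leaves the coefficient
      \<open>T n - (t n)\<^sup>2\<close>.\<close>
    have u_diff: "(norm (u (Suc n) - xs))\<^sup>2 - (norm (u n - xs))\<^sup>2
        = (t n)\<^sup>2 * (norm (d n))\<^sup>2 + 2 * t n * (d n \<bullet> (u n - xs))"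
      unfolding power2_norm_eq_inner u_Suc
      by (simp add: inner_simps inner_commute algebra_simps power2_eq_square[of "t n"])
    have "T n * \<delta> (Suc n) + l * ((norm (u (Suc n) - xs))\<^sup>2 - (norm (u n - xs))\<^sup>2
        + (T n - (t n)\<^sup>2) * (norm (d n))\<^sup>2) \<le> (T n - t n) * \<delta> n"
      using weighted unfolding u_diff by (simp add: algebra_simps)
    then have "(T n * \<delta> (Suc n) + l * ((norm (u (Suc n) - xs))\<^sup>2 - (norm (u n - xs))\<^sup>2
        + (T n - (t n)\<^sup>2) * (norm (d n))\<^sup>2)) / l \<le> (T n - t n) * \<delta> n / l"
      using \<open>l > 0\<close> by (simp add: divide_right_mono)
    then have "T n * \<delta> (Suc n) / l + (norm (u (Suc n) - xs))\<^sup>2 - (norm (u n - xs))\<^sup>2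
        + (T n - (t n)\<^sup>2) * (norm (d n))\<^sup>2 \<le> (T n - t n) * \<delta> n / l"
      using \<open>l > 0\<close> by (simp add: add_divide_distrib)
    then show ?thesis by (simp add: l_def mult_ac)
  qed
  have potential: "2 / L (Suc n) * (T n * \<delta> (Suc n)) + (norm (u (Suc n) - xs))\<^sup>2
      + (\<Sum>i\<le>n. (T i - (t i)\<^sup>2) * (norm (d i))\<^sup>2) \<le> (norm (y 0 - xs))\<^sup>2" for n
  proof (induction n)
    case 0
    have "u 0 = w 0" using t[of 0] by (simp add: u_def T)
    with step[of 0] show ?case by (simp add: T init)
  next
    case (Suc n)
    \<comment> \<open>Backtracking never decreases \<open>L\<close>, so the prefactor of the
      nonnegative gap can only shrink; with \<open>T (Suc n) - t (Suc n) = T n\<close> consecutive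
      steps fit together.\<close>
    have "2 / L (Suc (Suc n)) \<le> 2 / L (Suc n)"
      using L(1)[of "Suc n"] L(2)[of "Suc n"] by (intro divide_left_mono) (auto intro: mult_pos_pos less_le_trans)
    then have "2 / L (Suc (Suc n)) * (T n * \<delta> (Suc n)) \<le> 2 / L (Suc n) * (T n * \<delta> (Suc n))"
      using T_pos[of n] \<delta>_nonneg[of n] by (intro mult_right_mono) auto
    then show ?case using step[of "Suc n"] Suc.IH by (simp add: T)
  qed
  have "0 \<le> 2 / L (Suc n) * (T n * \<delta> (Suc n))"
    using L(1)[of "Suc n"] T_pos[of n] \<delta>_nonneg[of n] by (intro mult_nonneg_nonneg) (auto intro: less_imp_le)
  then show ?thesis
    using potential[of n] zero_le_power2[of "norm (u (Suc n) - xs)"] unfolding d_def by linarith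
qed

section \<open>Weights for affine parameters\<close>

lemma T_sum_affine:
  assumes "a > 0"
  shows "T_sum (\<lambda>j. (real j + a) / a) n = (real n + 1) * (real n + 2 * a) / (2 * a)"
proof (induction n)
  case (Suc n)
  have step: "T_sum (\<lambda>j. (real j + a) / a) (Suc n)
      = T_sum (\<lambda>j. (real j + a) / a) n + (real (Suc n) + a) / a"
    by (simp add: T_sum_def)
  show ?case unfolding step Suc.IH using assms by (simp add: field_simps)
qed (use assms in \<open>simp add: T_sum_def\<close>)

text \<open>The factored form shows that the weight vanishes at 0 and, once \<open>a > 2\<close>, is
  positive afterwards with leading coefficient \<open>(a - 2) / (2 * a\<^sup>2)\<close>, the source
  of \<open>a - 2\<close> in the rate.\<close>

lemma T_sum_affine_weight:
  assumes "a > 0"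
  shows "T_sum (\<lambda>j. (real j + a) / a) n - ((real n + a) / a)\<^sup>2
    = real n * ((a - 2) * real n + a * (2 * a - 3)) / (2 * a\<^sup>2)"
  unfolding T_sum_affine[OF assms] using assms by (simp add: field_simps power2_eq_square)

text \<open>An exact cubic formula for the sum reduces the bound to a polynomial inequality. At
  \<open>n = 0\<close> the sum is zero but the left side positive, hence the start at 1.\<close>

lemma sum_weight_lower_bound:
  assumes "a > 2" "n \<ge> 1"
  shows "(a - 2) * (real n + 1) ^ 3 / (6 * a\<^sup>2)
    \<le> (\<Sum>i\<le>n. real i * ((a - 2) * real i + a * (2 * a - 3)) / (2 * a\<^sup>2))"
proof -
  have closed_form: "(\<Sum>i\<le>n. real i * ((a - 2) * real i + a * (2 * a - 3)))
      = (real n + 1) * real n * ((a - 2) * (2 * real n + 1) + 3 * a * (2 * a - 3)) / 6" for n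
    by (induction n) (auto simp: field_simps)
  \<comment> \<open>After cancelling \<open>real n + 1\<close> and the quadratic terms, it remains
    to bound this left side by \<open>3 * a * (2 * a - 3) * real n\<close>.\<close>
  have "(a - 2) * (3 * real n + 2) \<le> (a - 2) * (5 * real n)"
    using assms by (intro mult_left_mono) auto
  also have "\<dots> = (5 * (a - 2)) * real n" by simp
  also have "\<dots> \<le> (3 * a * (2 * a - 3)) * real n"
  proof (intro mult_right_mono)
    \<comment> \<open>This is the difference of the two sides below, expanded in powers of
      \<open>a - 2\<close>.\<close>
    have "0 \<le> 6 * (a - 2)\<^sup>2 + 10 * (a - 2) + 6" using assms by (intro add_nonneg_nonneg) auto
    then show "5 * (a - 2) \<le> 3 * a * (2 * a - 3)" by (simp add: power2_eq_square algebra_simps)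
  qed simp
  finally have "2 * (a - 2) * (real n + 1)\<^sup>2
      \<le> real n * ((a - 2) * (2 * real n + 1) + 3 * a * (2 * a - 3))"
    by (simp add: power2_eq_square algebra_simps)
  then have "(real n + 1) * (2 * (a - 2) * (real n + 1)\<^sup>2)
      \<le> (real n + 1) * (real n * ((a - 2) * (2 * real n + 1) + 3 * a * (2 * a - 3)))"
    by (intro mult_left_mono) auto
  then have "2 * (a - 2) * (real n + 1) ^ 3
      \<le> (real n + 1) * real n * ((a - 2) * (2 * real n + 1) + 3 * a * (2 * a - 3))"
    by (simp add: power2_eq_square power3_eq_cube mult_ac)
  then have "2 * (a - 2) * (real n + 1) ^ 3 / 6 / (2 * a\<^sup>2)
      \<le> (\<Sum>i\<le>n. real i * ((a - 2) * real i + a * (2 * a - 3))) / (2 * a\<^sup>2)"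
    unfolding closed_form by (intro divide_right_mono) auto
  moreover have "2 * c * N / 6 / (2 * d) = c * N / (6 * d)" for c N d :: real by simp
  ultimately show ?thesis unfolding sum_divide_distrib by metis
qed

section \<open>Rate for the smallest step\<close>

theorem corollary5p1:
  fixes f :: "real^'n \<Rightarrow> ereal" and g :: "real^'m \<Rightarrow> ereal"
    and A :: "real^'n^'m"
    and \<sigma> a :: real
    and ystar :: "real^'m"
    and y w :: "nat \<Rightarrow> real^'m"
    and L :: "nat \<Rightarrow> real"
    and k :: nat and L' :: real
  assumes "proper f" "closed_fun f" "convex_fun f"
    and "proper g" "closed_fun g" "convex_fun g"
    and "\<sigma> > 0" "strongly_convex_fun \<sigma> f"
    and "is_arg_max (dual_fun f g A) (\<lambda>_. True) ystar"
    and "a > 2"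
    and "GFDPG f g A (\<lambda>j. (real j + a) / a) L y w"
    and "k \<ge> 1"
    and "L' > 0" "descent_cond f g A L' (y k)"
  shows "Min (insert (norm (p_map f g A L' (y k) - y k))
                ((\<lambda>i. norm (y i - w (i - 1))) ` {1..k}))
           \<le> a * sqrt 6 / sqrt (a - 2) * (norm (y 0 - ystar) / real k powr (3 / 2))"
    (is "?m \<le> _")
proof -
  note g = assms(4-6)
  obtain \<Phi> where F: "\<And>y. F_fun f A y = ereal (\<Phi> y)"
    and sub: "\<And>w y. \<Phi> w + (y - w) \<bullet> gradient (\<lambda>v. real_of_ereal (F_fun f A v)) w \<le> \<Phi> y"
    using F_fun_real_gradient[OF assms(1,2,8,7)] by blast
  define t where "t j = (real j + a) / a" for j
  \<comment> \<open>\<open>real_of_ereal\<close> sends infinite values to 0, so \<open>q\<close> is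
    meaningful only on the effective domain, which the next line isolates as
    \<open>D\<close>.\<close>
  define q where "q x = real_of_ereal (neg_dual_fun f g A x)" for x
  define D where "D = {x. neg_dual_fun f g A x = ereal (q x)}"
  have nd: "neg_dual_fun f g A x = ereal (\<Phi> x) + G_fun g x" "neg_dual_fun f g A x \<noteq> -\<infinity>" for x
    using G_fun_proper_closed_convex(1)[OF g]
    by (cases "G_fun g x"; auto simp: neg_dual_fun_def dual_fun_def F proper_def)+
  have opt: "neg_dual_fun f g A ystar \<le> neg_dual_fun f g A x" for x
    using assms(9) by (auto simp: is_arg_max_def neg_dual_fun_def ereal_uminus_le_reorder not_less)
  \<comment> \<open>A finite value at some \<open>v\<close> forces the optimal value to be finite,
    placing \<open>ystar\<close> in \<open>D\<close>.\<close>
  obtain v where "G_fun g v \<noteq> \<infinity>"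
    using G_fun_proper_closed_convex(1)[OF g] by (auto simp: proper_def)
  then have "neg_dual_fun f g A ystar \<noteq> \<infinity>" using opt[of v] nd by auto
  then have ystar: "ystar \<in> D" using nd(2)[of ystar] by (auto simp: D_def q_def ereal_real)
  have opt_real: "q ystar \<le> q x" if "x \<in> D" for x
    using opt[of x] ystar that by (simp add: D_def)
  have iter: "L n \<le> L (Suc n)" "descent_cond f g A (L (Suc n)) (w n)"
    "y (Suc n) = p_map f g A (L (Suc n)) (w n)"
    "w (Suc n) = y (Suc n)
      + ((T_sum t n - t n) * t (Suc n) / (t n * T_sum t (Suc n))) *\<^sub>R (y (Suc n) - y n)
      + (((t n)\<^sup>2 - T_sum t n) * t (Suc n) / (t n * T_sum t (Suc n))) *\<^sub>R (y (Suc n) - w n)" for n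
    using assms(11)[folded t_def, unfolded GFDPG_def, THEN conjunct2, THEN conjunct2, THEN conjunct2,
      THEN conjunct2, rule_format, of "Suc n"] by auto
  have init: "L 0 > 0" "y 0 = w 0" using assms(11) by (auto simp: GFDPG_def)
  have L_pos: "0 < L n" for n by (induction n) (use init iter(1) in \<open>auto intro: less_le_trans\<close>)
  have descent: "y (Suc n) \<in> D \<and>
      q (y (Suc n)) + L (Suc n) / 2 * ((norm (y (Suc n) - x))\<^sup>2 - (norm (w n - x))\<^sup>2) \<le> q x"
    if x: "x \<in> D" for n x
    by (rule proximal_gradient_inequality[OF F sub g L_pos iter(2,3), of x "q x" n])
      (use x in \<open>auto simp: D_def q_def\<close>)
  have T: "T_sum t 0 = t 0" "T_sum t (Suc n) = T_sum t n + t (Suc n)" for n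
    by (simp_all add: T_sum_def)
  have t_pos: "0 < t n" for n using \<open>a > 2\<close> by (simp add: t_def)
  define R where "R = norm (y 0 - ystar)"
  have m_le: "?m \<le> norm (y (Suc i) - w i)" if "i < k" for i
  proof (rule Min_le)
    have "norm (y (Suc i) - w (Suc i - 1)) \<in> (\<lambda>i. norm (y i - w (i - 1))) ` {1..k}"
      using that by (intro imageI) auto
    then show "norm (y (Suc i) - w i) \<in> insert (norm (p_map f g A L' (y k) - y k))
        ((\<lambda>i. norm (y i - w (i - 1))) ` {1..k})" by simp
  qed simp
  have m_nonneg: "0 \<le> ?m" by (intro Min.boundedI) auto
  \<comment> \<open>This is the claim squared and cleared of denominators.\<close>
  have "(a - 2) * real k ^ 3 * ?m\<^sup>2 \<le> 6 * a\<^sup>2 * R\<^sup>2"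
  proof (cases "k = 1")
    \<comment> \<open>All weights vanish for \<open>k = 1\<close>; there the bound follows from \<open>\<parallel>y 1 - y 0\<parallel> \<le> 2 R\<close>.\<close>
    case True
    have "L 1 / 2 * ((norm (y 1 - ystar))\<^sup>2 - R\<^sup>2) \<le> 0"
      using descent[OF ystar, of 0] opt_real[of "y 1"] init by (simp add: R_def)
    then have "(norm (y 1 - ystar))\<^sup>2 \<le> R\<^sup>2" using L_pos[of 1] by (simp add: mult_le_0_iff)
    then have "norm (y 1 - ystar) \<le> R" unfolding R_def by (rule power2_le_imp_le) simp
    then have "?m \<le> 2 * R"
      using m_le[of 0] True init norm_triangle_ineq4[of "y 1 - ystar" "y 0 - ystar"]
      by (simp add: R_def)
    then have "?m\<^sup>2 \<le> (2 * R)\<^sup>2" using m_nonneg by (rule power_mono)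
    then have "(a - 2) * ?m\<^sup>2 \<le> (a - 2) * (4 * R\<^sup>2)"
      using \<open>a > 2\<close> by (intro mult_left_mono) (auto simp: power_mult_distrib)
    also have "\<dots> = (4 * (a - 2)) * R\<^sup>2" by simp
    also have "\<dots> \<le> 6 * a\<^sup>2 * R\<^sup>2"
    proof (intro mult_right_mono)
      have "a \<le> a\<^sup>2" using \<open>a > 2\<close> by (intro self_le_power) auto
      then have "6 * a \<le> 6 * a\<^sup>2" by simp
      with \<open>a > 2\<close> show "4 * (a - 2) \<le> 6 * a\<^sup>2" by simp
    qed simp
    finally show ?thesis by (simp add: True)
  next
    case False
    \<comment> \<open>With \<open>k = Suc n\<close>, the sum over \<open>i \<le> n\<close> runs
      through exactly the \<open>k\<close> steps from \<open>w i\<close> to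
      \<open>y (Suc i)\<close>, and \<open>real n + 1\<close> in the weight bound is
      \<open>real k\<close>.\<close>
    then obtain n where n: "k = Suc n" "n \<ge> 1" using \<open>k \<ge> 1\<close> by (cases k) auto
    define c where "c i = real i * ((a - 2) * real i + a * (2 * a - 3)) / (2 * a\<^sup>2)" for i
    have c_nonneg: "0 \<le> c i" for i using \<open>a > 2\<close> by (auto simp: c_def)
    have weight: "T_sum t i - (t i)\<^sup>2 = c i" for i
      using T_sum_affine_weight[of a i] \<open>a > 2\<close> by (simp add: t_def[abs_def] c_def)
    have "(\<Sum>i\<le>n. (T_sum t i - (t i)\<^sup>2) * (norm (y (Suc i) - w i))\<^sup>2) \<le> R\<^sup>2"
      unfolding R_def
      by (rule accelerated_potential[where D = D and q = q and L = L])
        (use descent ystar opt_real t_pos T L_pos iter init in auto)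
    moreover have "(\<Sum>i\<le>n. c i) * ?m\<^sup>2 \<le> (\<Sum>i\<le>n. c i * (norm (y (Suc i) - w i))\<^sup>2)"
      unfolding sum_distrib_right
      using m_le m_nonneg c_nonneg n by (intro sum_mono mult_left_mono power_mono) auto
    moreover have "(a - 2) * real k ^ 3 / (6 * a\<^sup>2) * ?m\<^sup>2 \<le> (\<Sum>i\<le>n. c i) * ?m\<^sup>2"
      using sum_weight_lower_bound[OF \<open>a > 2\<close> n(2)] n
      by (intro mult_right_mono) (auto simp: c_def add.commute)
    ultimately have "(a - 2) * real k ^ 3 / (6 * a\<^sup>2) * ?m\<^sup>2 \<le> R\<^sup>2" by (simp add: weight)
    then show ?thesis using \<open>a > 2\<close> by (simp add: field_simps)
  qed
  then have "sqrt ((a - 2) * real k ^ 3 * ?m\<^sup>2) \<le> sqrt (6 * a\<^sup>2 * R\<^sup>2)" by (rule real_sqrt_le_mono)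
  moreover have "sqrt (real k ^ 3) = real k powr (3 / 2)"
  proof -
    have "sqrt (real k ^ 3) = (real k powr 3) powr (1 / 2)"
      using \<open>k \<ge> 1\<close> by (simp add: powr_half_sqrt powr_numeral)
    then show ?thesis by (simp only: powr_powr) simp
  qed
  ultimately have "sqrt (a - 2) * real k powr (3 / 2) * ?m \<le> sqrt 6 * a * R"
    using \<open>a > 2\<close> m_nonneg by (simp add: real_sqrt_mult R_def)
  then have "?m \<le> sqrt 6 * a * R / (sqrt (a - 2) * real k powr (3 / 2))"
    using \<open>a > 2\<close> \<open>k \<ge> 1\<close> by (simp add: pos_le_divide_eq mult_ac)
  then show ?thesis by (simp add: R_def mult_ac)
qed

end
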